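(* Let $R$ be a finite commutative principal ideal ring, and let $\mathbf{A}$ and $\mathbf{Q}$ be the $(t+1)\times(t+1)$ matrices with rows and columns indexed by $\{0,1,\dots,t\}$ such that the $(i,j)$ entry of $\mathbf A$ is $1$ if $a_iR\subseteq a_jR$ and $0$ otherwise, and the $(i,j)$ entry of $\mathbf Q$ is $1$ if $a_jR\subseteq(a_iR)^\perp$ and $0$ otherwise. Then $$\mathbf{Q}=\mathbf{A}\mathbf{P}$$ for some permutation matrix $\mathbf{P}$. Furthermore, there exists a choice of (indexed) representatives $\{a_0,a_1,\dots,a_t\}$ of the equivalence classes of $\approx$ such that $\mathbf{Q}=\mathbf{A}\mathbf{J}$, that is, such that $\mathbf P=\mathbf J$ is the anti-diagonal $(t+1)\times(t+1)$ matrix with all anti-diagonal entries equal to $1$.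
   Context: Rings have an identity. A finite commutative principal ideal ring is a finite commutative ring in which every ideal has the form $aR=\{ab:b\in R\}$ for some $a\in R$. On $R$, $r\approx s$ means $r=us$ for some unit $u$ of $R$, equivalently $rR=sR$. Let $t$ be the number of nonzero principal ideals of $R$; $\{a_0,\dots,a_t\}$ is an indexed set of representatives of the $t+1$ classes of $\approx$, so $a_0R,\dots,a_tR$ are pairwise distinct and are all the principal ideals of $R$. For $c\in R$, $(cR)^\perp=\{r\in R: cr=0\}$. *)

theory Defs
  imports
    "HOL-Algebra.Ideal"
    "HOL-Combinatorics.Permutations"
    "Jordan_Normal_Form.Matrix"
begin

text \<open>The zero ring is not excluded.\<close>

locale finite_principal_ideal_cring = cring +
  assumes finite_carrier: "finite (carrier R)"
    and principal: "ideal I R \<Longrightarrow> \<exists>a\<in>carrier R. I = PIdl a"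

definition principal_ideals :: "('a, 'b) ring_scheme \<Rightarrow> 'a set set" where
  "principal_ideals R = {PIdl\<^bsub>R\<^esub> a | a. a \<in> carrier R}"

definition unit_assoc :: "('a, 'b) ring_scheme \<Rightarrow> ('a \<times> 'a) set" where
  "unit_assoc R = {(r, s). r \<in> carrier R \<and> s \<in> carrier R \<and> (\<exists>u\<in>Units R. r = u \<otimes>\<^bsub>R\<^esub> s)}"

text \<open>Values of \<open>a\<close> outside \<open>{0..t}\<close> are irrelevant.\<close>

definition assoc_reps :: "('a, 'b) ring_scheme \<Rightarrow> nat \<Rightarrow> (nat \<Rightarrow> 'a) \<Rightarrow> bool" where
  "assoc_reps R t a \<longleftrightarrow>
     (\<forall>i\<in>{0..t}. a i \<in> carrier R) \<and>
     bij_betw (\<lambda>i. unit_assoc R `` {a i}) {0..t} (carrier R // unit_assoc R)"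

text \<open>For an element \<open>c\<close>, this is the annihilator \<open>(cR)\<^sup>\<bottom>\<close> of the ideal generated by \<open>c\<close>.\<close>

definition perp :: "('a, 'b) ring_scheme \<Rightarrow> 'a \<Rightarrow> 'a set" where
  "perp R c = {r \<in> carrier R. c \<otimes>\<^bsub>R\<^esub> r = \<zero>\<^bsub>R\<^esub>}"

definition incl_mat :: "('a, 'b) ring_scheme \<Rightarrow> nat \<Rightarrow> (nat \<Rightarrow> 'a) \<Rightarrow> int mat" where
  "incl_mat R t a = mat (t + 1) (t + 1)
     (\<lambda>(i, j). if PIdl\<^bsub>R\<^esub> (a i) \<subseteq> PIdl\<^bsub>R\<^esub> (a j) then 1 else 0)"

definition perp_mat :: "('a, 'b) ring_scheme \<Rightarrow> nat \<Rightarrow> (nat \<Rightarrow> 'a) \<Rightarrow> int mat" where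
  "perp_mat R t a = mat (t + 1) (t + 1)
     (\<lambda>(i, j). if PIdl\<^bsub>R\<^esub> (a j) \<subseteq> perp R (a i) then 1 else 0)"

definition permutation_mat :: "nat \<Rightarrow> int mat \<Rightarrow> bool" where
  "permutation_mat n P \<longleftrightarrow>
     (\<exists>p. p permutes {0..<n} \<and> P = mat n n (\<lambda>(i, j). if i = p j then 1 else 0))"

definition antidiag_mat :: "nat \<Rightarrow> int mat" where
  "antidiag_mat n = mat n n (\<lambda>(i, j). if i + j + 1 = n then 1 else 0)"

end

theory Submission
  imports Defs
begin

text \<open>
  Since multiplication by \<open>a\<close> has image \<open>aR\<close> and kernel \<open>(aR)\<^sup>\<bottom>\<close>, we have
  \<open>|aR| |(aR)\<^sup>\<bottom>| = |R|\<close>, so \<open>\<bottom>\<close> is an inclusion-reversing involution on the (principal) ideals.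
  Hence \<open>a\<^sub>jR \<subseteq> (a\<^sub>iR)\<^sup>\<bottom>\<close> iff \<open>a\<^sub>iR \<subseteq> (a\<^sub>jR)\<^sup>\<bottom> = a\<^sub>p\<^sub>(\<^sub>j\<^sub>)R\<close> for a permutation \<open>p\<close>, which is \<open>Q = AP\<close>.
  At most one ideal equals its own annihilator, so the ideals can be listed such that \<open>\<bottom>\<close>
  reverses the list, and then \<open>P = J\<close>.
\<close>

section \<open>Preliminaries on involutions, matrix columns and powers in finite monoids\<close>

text \<open>By induction: a non-fixed \<open>x\<close> goes to the front and \<open>f x\<close> to
  the end of a list for the remaining elements. Once only fixed points are left there is at most
  one, and it ends up in the middle.\<close>

lemma involution_list:
  assumes "finite S" and "\<And>x. x \<in> S \<Longrightarrow> f x \<in> S" and "\<And>x. x \<in> S \<Longrightarrow> f (f x) = x"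
    and "\<And>x y. x \<in> S \<Longrightarrow> y \<in> S \<Longrightarrow> f x = x \<Longrightarrow> f y = y \<Longrightarrow> x = y"
  shows "\<exists>xs. distinct xs \<and> set xs = S \<and> map f xs = rev xs"
  using assms
proof (induction "card S" arbitrary: S rule: less_induct)
  case less
  show ?case
  proof (cases "\<exists>x\<in>S. f x \<noteq> x")
    case True
    then obtain x where x: "x \<in> S" "f x \<noteq> x" by blast
    let ?T = "S - {x, f x}"
    have inv: "f y \<in> ?T" if "y \<in> ?T" for y
      using that less.prems(2,3) x by (metis Diff_iff insert_iff singletonD)
    have "card ?T < card S"
      using x less.prems(1) by (intro psubset_card_mono) auto
    then obtain xs where xs: "distinct xs" "set xs = ?T" "map f xs = rev xs"
      using less.hyps[of ?T] less.prems inv by (metis Diff_iff finite_Diff)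
    have "distinct (x # xs @ [f x]) \<and> set (x # xs @ [f x]) = S \<and>
        map f (x # xs @ [f x]) = rev (x # xs @ [f x])"
      using xs x less.prems(2,3) by auto
    then show ?thesis by blast
  next
    case False
    then consider "S = {}" | x where "S = {x}" "f x = x"
      using less.prems(4) by (metis is_singletonI' is_singleton_the_elem insertI1)
    then show ?thesis
    proof cases
      case 1
      then show ?thesis by (intro exI[of _ "[]"]) auto
    next
      case (2 x)
      then show ?thesis by (intro exI[of _ "[x]"]) auto
    qed
  qed
qed

text \<open>Column \<open>j\<close> of the right factor is the unit vector with its one in row
  \<open>p j\<close>.\<close>

lemma mat_mult_column_selection:
  fixes f :: "nat \<times> nat \<Rightarrow> 'a :: semiring_1"
  assumes "\<And>j. j < n \<Longrightarrow> p j < n"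
  shows "mat n n f * mat n n (\<lambda>(i, j). if i = p j then 1 else 0) = mat n n (\<lambda>(i, j). f (i, p j))"
proof (rule eq_matI)
  fix i j assume ij: "i < dim_row (mat n n (\<lambda>(i, j). f (i, p j)))"
    "j < dim_col (mat n n (\<lambda>(i, j). f (i, p j)))"
  have "(mat n n f * mat n n (\<lambda>(i, j). if i = p j then 1 else 0)) $$ (i, j) =
      (\<Sum>k = 0..<n. f (i, k) * (if k = p j then 1 else 0))"
    using ij by (simp add: scalar_prod_def)
  also have "\<dots> = (\<Sum>k = 0..<n. if k = p j then f (i, k) else 0)"
    by (intro sum.cong) auto
  also have "\<dots> = f (i, p j)"
    using ij assms by simp
  finally show "(mat n n f * mat n n (\<lambda>(i, j). if i = p j then 1 else 0)) $$ (i, j) =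
      mat n n (\<lambda>(i, j). f (i, p j)) $$ (i, j)"
    using ij by simp
qed auto

text \<open>The powers of \<open>x\<close> repeat with some period \<open>k\<close> from some
  exponent \<open>m\<close> on. The exponent \<open>m * k\<close> is a multiple of the period and
  not below \<open>m\<close>, so doubling it changes nothing.\<close>

lemma (in monoid) finite_idempotent_power:
  assumes "finite (carrier G)" and x: "x \<in> carrier G"
  shows "\<exists>n::nat. n > 0 \<and> x [^] n \<otimes> x [^] n = x [^] n"
proof -
  have "\<not> inj_on (\<lambda>n::nat. x [^] n) {1..}"
  proof
    assume "inj_on (\<lambda>n::nat. x [^] n) {1..}"
    moreover have "finite ((\<lambda>n::nat. x [^] n) ` {1..})"
      using x by (intro finite_subset[OF _ assms(1)]) auto
    ultimately show False
      using finite_imageD infinite_Ici by blast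
  qed
  then obtain m l :: nat where "m \<ge> 1" "m < l" "x [^] m = x [^] l"
    unfolding inj_on_def by (metis atLeast_iff linorder_neqE_nat)
  then obtain k where k: "k > 0" and m: "m \<ge> 1" and eq: "x [^] m = x [^] (m + k)"
    by (metis less_imp_add_positive)
  have shift: "x [^] m = x [^] (m + j * k)" for j
  proof (induction j)
    case (Suc j)
    have "x [^] (m + Suc j * k) = x [^] (m + k) \<otimes> x [^] (j * k)"
      using x by (simp add: nat_pow_mult algebra_simps)
    also have "\<dots> = x [^] (m + j * k)"
      using x by (simp add: nat_pow_mult flip: eq)
    finally show ?case using Suc by simp
  qed simp
  \<comment> \<open>Since \<open>k > 0\<close>, \<open>m \<le> m * k\<close> and the subtraction is
    not truncated.\<close>
  have "x [^] (m * k) = x [^] m \<otimes> x [^] (m * k - m)"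
    using x k by (simp add: nat_pow_mult)
  also have "\<dots> = x [^] (m + m * k) \<otimes> x [^] (m * k - m)"
    using shift[of m] by simp
  also have "\<dots> = x [^] (m * k) \<otimes> x [^] (m * k)"
    using x k by (simp add: nat_pow_mult)
  finally show ?thesis
    using m k by (intro exI[of _ "m * k"]) simp
qed

section \<open>Annihilators of principal ideals\<close>

context cring
begin

lemma PIdl_subset_iff:
  assumes "a \<in> carrier R" "b \<in> carrier R"
  shows "PIdl a \<subseteq> PIdl b \<longleftrightarrow> a \<in> PIdl b"
  using assms cgenideal_self cgenideal_minimal[OF cgenideal_ideal] by blast

lemma perp_closed: "perp R a \<subseteq> carrier R"
  by (auto simp: perp_def)

lemma perp_ideal:
  assumes a: "a \<in> carrier R"
  shows "ideal (perp R a) R"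
proof (rule idealI)
  show "subgroup (perp R a) (add_monoid R)"
    using a by unfold_locales (auto simp: perp_def r_distr r_minus simp flip: a_inv_def)
  show "x \<otimes> r \<in> perp R a" if "r \<in> perp R a" "x \<in> carrier R" for r x
    using that a by (simp add: perp_def m_lcomm[of a])
  then show "r \<otimes> x \<in> perp R a" if "r \<in> perp R a" "x \<in> carrier R" for r x
    using that perp_closed by (metis m_comm subsetD)
qed (rule ring_axioms)

text \<open>The condition on the right is symmetric, which lets \<open>a\<close> and
  \<open>b\<close> change places.\<close>

lemma PIdl_subset_perp_iff:
  assumes "a \<in> carrier R" "b \<in> carrier R"
  shows "PIdl b \<subseteq> perp R a \<longleftrightarrow> a \<otimes> b = \<zero>"
proof -
  have "PIdl b \<subseteq> perp R a \<longleftrightarrow> b \<in> perp R a"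
    using assms cgenideal_self cgenideal_minimal[OF perp_ideal] by blast
  then show ?thesis using assms by (simp add: perp_def)
qed

text \<open>In place of a quotient, a section \<open>g\<close> of multiplication by \<open>a\<close>
  gives an explicit bijection: each ring element is uniquely a chosen preimage plus an annihilator
  element.\<close>

lemma card_PIdl_perp:
  assumes fin: "finite (carrier R)" and a: "a \<in> carrier R"
  shows "card (PIdl a) * card (perp R a) = card (carrier R)"
proof -
  have "\<forall>y\<in>PIdl a. \<exists>x. x \<in> carrier R \<and> y = a \<otimes> x"
    using a by (auto simp: cgenideal_def m_comm)
  then obtain g where g: "\<And>y. y \<in> PIdl a \<Longrightarrow> g y \<in> carrier R"
    and ag: "\<And>y. y \<in> PIdl a \<Longrightarrow> y = a \<otimes> g y"
    by metis
  have m: "a \<otimes> (g y \<oplus> r) = y" if "y \<in> PIdl a" "r \<in> perp R a" for y r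
  proof -
    have "a \<otimes> (g y \<oplus> r) = a \<otimes> g y"
      using that a g by (simp add: perp_def r_distr)
    then show ?thesis using that ag by simp
  qed
  have "bij_betw (\<lambda>(y, r). g y \<oplus> r) ((PIdl a) \<times> perp R a) (carrier R)"
  proof (rule bij_betw_imageI)
    show "inj_on (\<lambda>(y, r). g y \<oplus> r) ((PIdl a) \<times> perp R a)"
    proof (rule inj_onI, clarify)
      fix y r y' r'
      assume *: "y \<in> PIdl a" "r \<in> perp R a" "y' \<in> PIdl a" "r' \<in> perp R a"
        and eq: "g y \<oplus> r = g y' \<oplus> r'"
      have "y = y'" using m[of y r] m[of y' r'] * eq by simp
      moreover have "r = r'"
        using eq r_neg1[of "g y" r] r_neg1[of "g y'" r'] * g perp_closed \<open>y = y'\<close>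
        by (metis subsetD)
      ultimately show "y = y' \<and> r = r'" ..
    qed
    show "(\<lambda>(y, r). g y \<oplus> r) ` ((PIdl a) \<times> perp R a) = carrier R"
    proof (intro equalityI subsetI)
      fix x assume x: "x \<in> carrier R"
      let ?y = "a \<otimes> x"
      have y: "?y \<in> PIdl a" using m_comm[OF a x] x by (auto simp: cgenideal_def)
      have "a \<otimes> (x \<ominus> g ?y) = a \<otimes> x \<ominus> a \<otimes> g ?y"
        using a x g[OF y] by (simp add: a_minus_def r_distr r_minus)
      also have "\<dots> = \<zero>" using a x by (simp add: a_minus_def r_neg flip: ag[OF y])
      finally have "x \<ominus> g ?y \<in> perp R a"
        using a x g[OF y] by (simp add: perp_def)
      moreover have "x = g ?y \<oplus> (x \<ominus> g ?y)"
        using x g[OF y] by algebra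
      ultimately show "x \<in> (\<lambda>(y, r). g y \<oplus> r) ` ((PIdl a) \<times> perp R a)"
        using y by (intro image_eqI[of _ _ "(?y, x \<ominus> g ?y)"]) auto
    qed (use g perp_closed in auto)
  qed
  then have "card ((PIdl a) \<times> perp R a) = card (carrier R)"
    by (rule bij_betw_same_card)
  then show ?thesis by (simp add: card_cartesian_product)
qed

text \<open>Symmetry of \<open>a \<otimes> b = \<zero>\<close> gives one inclusion. The counting
  formula for \<open>a\<close> and for \<open>b\<close> makes both sides equally large.\<close>

lemma perp_PIdl_involution:
  assumes fin: "finite (carrier R)" and a: "a \<in> carrier R" and b: "b \<in> carrier R"
    and eq: "PIdl b = perp R a"
  shows "PIdl a = perp R b"
proof (rule card_subset_eq)
  show "finite (perp R b)" using fin perp_closed finite_subset by blast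
  show "PIdl a \<subseteq> perp R b"
    using PIdl_subset_perp_iff[OF a b] PIdl_subset_perp_iff[OF b a] eq a b by (simp add: m_comm)
  \<comment> \<open>Makes the common factor nonzero, so that it can be cancelled.\<close>
  have "\<zero> \<in> perp R a" using a by (simp add: perp_def)
  then have "card (perp R a) \<noteq> 0"
    using finite_subset[OF perp_closed fin] by (metis card_0_eq empty_iff)
  moreover have "card (PIdl a) * card (perp R a) = card (perp R a) * card (perp R b)"
    using card_PIdl_perp[OF fin a] card_PIdl_perp[OF fin b] eq by simp
  ultimately show "card (PIdl a) = card (perp R b)" by simp
qed

section \<open>Associate elements and equal principal ideals\<close>

text \<open>A multiplier \<open>x\<close> with \<open>r = x \<otimes> s\<close> may fail to be a
  unit. Some power \<open>e\<close> of \<open>x\<close> is idempotent and fixes \<open>s\<close>, so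
  \<open>x\<close> can be replaced by one on the complementary factor without changing its product
  with \<open>s\<close>.\<close>

lemma PIdl_eq_imp_unit_multiple:
  assumes fin: "finite (carrier R)" and r: "r \<in> carrier R" and s: "s \<in> carrier R"
    and eq: "PIdl r = PIdl s"
  shows "\<exists>u\<in>Units R. r = u \<otimes> s"
proof -
  obtain x where x: "x \<in> carrier R" "r = x \<otimes> s"
    using cgenideal_self[OF r] eq by (auto simp: cgenideal_def)
  obtain y where y: "y \<in> carrier R" "s = y \<otimes> r"
    using cgenideal_self[OF s] eq by (auto simp: cgenideal_def)
  obtain n :: nat where n: "n > 0" "x [^] n \<otimes> x [^] n = x [^] n"
    using finite_idempotent_power[OF fin x(1)] by blast
  define e where "e = x [^] n"
  \<comment> \<open>As \<open>n > 0\<close>, \<open>z\<close> satisfies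
    \<open>x \<otimes> z = e\<close>, so it inverts \<open>x\<close> modulo the complement of
    \<open>e\<close>.\<close>
  define z where "z = x [^] (n - 1)"
  have e: "e \<in> carrier R" and z: "z \<in> carrier R" using x by (auto simp: e_def z_def)
  have ee: "e \<otimes> e = e" using n by (simp add: e_def)
  have xz: "x \<otimes> z = e"
    using n x nat_pow_mult[OF x(1), of 1 "n - 1"] by (simp add: e_def z_def)
  \<comment> \<open>Iterates \<open>s = y \<otimes> (x \<otimes> s)\<close>. At \<open>k = n\<close>
    it exhibits \<open>s\<close> as a multiple of \<open>e\<close>, whence \<open>e\<close> fixes
    \<open>s\<close>.\<close>
  have s_pow: "s = y [^] k \<otimes> x [^] k \<otimes> s" for k :: nat
  proof (induction k)
    case (Suc k)
    have "y [^] Suc k \<otimes> x [^] Suc k \<otimes> s = y [^] k \<otimes> x [^] k \<otimes> (y \<otimes> (x \<otimes> s))"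
      using m_assoc m_lcomm x(1) y(1) s by simp
    also have "y \<otimes> (x \<otimes> s) = s" using x(2) y(2) by metis
    finally show ?case using Suc by simp
  qed (use s in simp)
  have "e \<otimes> s = y [^] n \<otimes> (e \<otimes> e) \<otimes> s"
    using s_pow[of n] x(1) y(1) s e by (metis e_def m_lcomm m_assoc nat_pow_closed m_closed)
  then have es: "e \<otimes> s = s" using s_pow[of n] ee by (simp add: e_def)
  txt \<open>On the factor \<open>eR\<close> of \<open>R = eR \<times> (1 - e)R\<close>, \<open>x\<close> is invertible.\<close>
  let ?u = "x \<otimes> e \<oplus> (\<one> \<ominus> e)"
  let ?v = "z \<otimes> e \<oplus> (\<one> \<ominus> e)"
  \<comment> \<open>Grouped so that the differences \<open>e \<ominus> e \<otimes> e\<close> vanish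
    by idempotence.\<close>
  have "?u \<otimes> ?v = x \<otimes> z \<otimes> (e \<otimes> e) \<oplus> (x \<oplus> z) \<otimes> (e \<ominus> e \<otimes> e) \<oplus> (\<one> \<ominus> e \<ominus> (e \<ominus> e \<otimes> e))"
    using x(1) z e by algebra
  also have "\<dots> = \<one>"
    unfolding xz ee using x(1) z e ee by algebra
  finally have "?u \<otimes> ?v = \<one>" .
  then have "?u \<in> Units R"
    using x(1) z e m_comm[of ?u ?v] by (auto simp: Units_def)
  moreover have "?u \<otimes> s = x \<otimes> (e \<otimes> s) \<oplus> (s \<ominus> e \<otimes> s)"
    using x(1) e s by algebra
  then have "r = ?u \<otimes> s" using x es s by (simp add: a_minus_def r_neg)
  ultimately show ?thesis by blast
qed

lemma unit_assoc_iff: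
  assumes "finite (carrier R)"
  shows "(r, s) \<in> unit_assoc R \<longleftrightarrow> r \<in> carrier R \<and> s \<in> carrier R \<and> PIdl r = PIdl s"
proof
  assume "(r, s) \<in> unit_assoc R"
  then obtain u where rs: "r \<in> carrier R" "s \<in> carrier R" and u: "u \<in> Units R" "r = u \<otimes> s"
    by (auto simp: unit_assoc_def)
  have "s = inv u \<otimes> r"
    using u rs by (simp add: Units_closed flip: m_assoc)
  then have "r \<in> PIdl s" "s \<in> PIdl r"
    using u rs by (auto simp: cgenideal_def Units_closed)
  then show "r \<in> carrier R \<and> s \<in> carrier R \<and> PIdl r = PIdl s"
    using rs PIdl_subset_iff by blast
next
  assume "r \<in> carrier R \<and> s \<in> carrier R \<and> PIdl r = PIdl s"
  then show "(r, s) \<in> unit_assoc R"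
    using PIdl_eq_imp_unit_multiple[OF assms] by (auto simp: unit_assoc_def)
qed

text \<open>On the carrier, the class of an element and its principal ideal determine each other.
  Representatives can thus be handled as an indexing of the ideals.\<close>

lemma assoc_reps_iff:
  assumes fin: "finite (carrier R)"
  shows "assoc_reps R t a \<longleftrightarrow> (\<forall>i\<in>{0..t}. a i \<in> carrier R) \<and>
    bij_betw (\<lambda>i. PIdl (a i)) {0..t} (principal_ideals R)"
proof (cases "\<forall>i\<in>{0..t}. a i \<in> carrier R")
  case True
  define cls where "cls = (\<lambda>c. unit_assoc R `` {c})"
  have cls_eq: "cls c = {d \<in> carrier R. PIdl c = PIdl d}" if "c \<in> carrier R" for c
    using that by (auto simp: cls_def unit_assoc_iff[OF fin])
  have cls_iff: "cls c = cls d \<longleftrightarrow> PIdl c = PIdl d" if "c \<in> carrier R" "d \<in> carrier R" for c d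
    using that by (auto simp: cls_eq)
  have quot: "carrier R // unit_assoc R = cls ` carrier R"
    by (auto simp: quotient_def cls_def)
  have pr: "principal_ideals R = cgenideal R ` carrier R"
    by (auto simp: principal_ideals_def)
  have inj: "inj_on (\<lambda>i. cls (a i)) {0..t} \<longleftrightarrow> inj_on (\<lambda>i. PIdl (a i)) {0..t}"
    using True by (auto simp: inj_on_def cls_iff)
  have "(\<lambda>i. cls (a i)) ` {0..t} = cls ` carrier R \<longleftrightarrow>
      (\<forall>c\<in>carrier R. \<exists>i\<in>{0..t}. cls c = cls (a i))"
    using True by (auto simp: image_iff set_eq_iff)
  also have "\<dots> \<longleftrightarrow> (\<forall>c\<in>carrier R. \<exists>i\<in>{0..t}. PIdl c = PIdl (a i))"
    using True cls_iff by (intro ball_cong bex_cong) auto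
  also have "\<dots> \<longleftrightarrow> (\<lambda>i. PIdl (a i)) ` {0..t} = cgenideal R ` carrier R"
    using True by (auto simp: image_iff set_eq_iff)
  finally show ?thesis
    using True inj by (simp add: assoc_reps_def bij_betw_def quot pr cls_def)
qed (auto simp: assoc_reps_def)

section \<open>Annihilators in matrix form\<close>

text \<open>Serves both claims: \<open>p\<close> is a permutation obtained from annihilators in the
  first and \<open>j \<mapsto> t - j\<close> in the second.\<close>

lemma perp_mat_eq_incl_mat_mult:
  assumes a: "\<And>i. i < t + 1 \<Longrightarrow> a i \<in> carrier R" and p: "\<And>j. j < t + 1 \<Longrightarrow> p j < t + 1"
    and perp: "\<And>j. j < t + 1 \<Longrightarrow> PIdl (a (p j)) = perp R (a j)"
  shows "perp_mat R t a =
    incl_mat R t a * mat (t + 1) (t + 1) (\<lambda>(i, j). if i = p j then 1 else 0)"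
proof -
  have "PIdl (a j) \<subseteq> perp R (a i) \<longleftrightarrow> PIdl (a i) \<subseteq> PIdl (a (p j))"
    if "i < t + 1" "j < t + 1" for i j
    using that a by (simp only: perp PIdl_subset_perp_iff m_comm)
  then have "perp_mat R t a = mat (t + 1) (t + 1)
      (\<lambda>(i, j). (\<lambda>(i, j). if PIdl (a i) \<subseteq> PIdl (a j) then 1 else 0) (i, p j))"
    unfolding perp_mat_def by (intro cong_mat) auto
  also have "\<dots> = incl_mat R t a * mat (t + 1) (t + 1) (\<lambda>(i, j). if i = p j then 1 else 0)"
    unfolding incl_mat_def by (rule mat_mult_column_selection[symmetric, OF p])
  finally show ?thesis .
qed

end

section \<open>Self-annihilating ideals and the two matrix identities\<close>

context finite_principal_ideal_cring
begin

lemma perp_principal: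
  assumes "a \<in> carrier R"
  shows "\<exists>b\<in>carrier R. PIdl b = perp R a"
  using principal[OF perp_ideal[OF assms]] by metis

text \<open>It suffices that \<open>a \<otimes> b = \<zero>\<close>: then each ideal lies in the
  annihilator of the other, which is that other ideal. As \<open>a\<close> and \<open>b\<close> are
  multiples of a generator \<open>d\<close> of the sum of the two ideals, this follows from
  \<open>d \<otimes> d = \<zero>\<close>.\<close>

lemma self_perp_unique:
  assumes a: "a \<in> carrier R" and b: "b \<in> carrier R"
    and pa: "PIdl a = perp R a" and pb: "PIdl b = perp R b"
  shows "PIdl a = PIdl b"
proof -
  have aa: "a \<otimes> a = \<zero>" and bb: "b \<otimes> b = \<zero>"
    using cgenideal_self[OF a] cgenideal_self[OF b] pa pb by (auto simp: perp_def)
  have "ideal ((PIdl a) <+>\<^bsub>R\<^esub> (PIdl b)) R"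
    using a b by (intro add_ideals cgenideal_ideal)
  then obtain d where d: "d \<in> carrier R" and D: "(PIdl a) <+>\<^bsub>R\<^esub> (PIdl b) = PIdl d"
    using principal by blast
  have mem: "x \<otimes> a \<oplus> y \<otimes> b \<in> PIdl d" if "x \<in> carrier R" "y \<in> carrier R" for x y
  proof -
    have "x \<otimes> a \<oplus> y \<otimes> b \<in> (PIdl a) <+>\<^bsub>R\<^esub> (PIdl b)"
      unfolding set_add_def' cgenideal_def using that by blast
    then show ?thesis by (simp only: D)
  qed
  obtain a' where a': "a' \<in> carrier R" "a = a' \<otimes> d"
    using mem[of \<one> \<zero>] a b by (auto simp: cgenideal_def)
  obtain b' where b': "b' \<in> carrier R" "b = b' \<otimes> d"
    using mem[of \<zero> \<one>] a b by (auto simp: cgenideal_def)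
  obtain x y where xy: "x \<in> carrier R" "y \<in> carrier R" and dxy: "d = x \<otimes> a \<oplus> y \<otimes> b"
  proof -
    have "d \<in> (PIdl a) <+>\<^bsub>R\<^esub> (PIdl b)"
      using cgenideal_self[OF d] by (simp only: D)
    then show ?thesis
      using that unfolding set_add_def' cgenideal_def by blast
  qed
  txt \<open>The element \<open>w\<close> fixes \<open>d\<close>, and \<open>w\<^sup>3\<close> lies in the ideal generated by \<open>a'\<^sup>2\<close> and \<open>b'\<^sup>2\<close>,
    which annihilates \<open>d\<^sup>2\<close>.\<close>
  define w where "w = x \<otimes> a' \<oplus> y \<otimes> b'"
  have w: "w \<in> carrier R" using xy a' b' by (simp add: w_def)
  have dw: "d \<otimes> w = d"
  proof -
    have "d \<otimes> w = x \<otimes> (a' \<otimes> d) \<oplus> y \<otimes> (b' \<otimes> d)"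
      unfolding w_def using xy a'(1) b'(1) d by algebra
    then show ?thesis by (simp flip: a'(2) b'(2) dxy)
  qed
  define p q where "p = x \<otimes> a'" and "q = y \<otimes> b'"
  have pq: "p \<in> carrier R" "q \<in> carrier R" using xy a'(1) b'(1) by (auto simp: p_def q_def)
  have "d \<otimes> d \<otimes> (p \<otimes> p) = x \<otimes> x \<otimes> ((a' \<otimes> d) \<otimes> (a' \<otimes> d))"
    unfolding p_def using xy(1) a'(1) d by algebra
  then have ddp: "d \<otimes> d \<otimes> (p \<otimes> p) = \<zero>"
    using aa xy by (simp flip: a'(2))
  have "d \<otimes> d \<otimes> (q \<otimes> q) = y \<otimes> y \<otimes> ((b' \<otimes> d) \<otimes> (b' \<otimes> d))"
    unfolding q_def using xy(2) b'(1) d by algebra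
  then have ddq: "d \<otimes> d \<otimes> (q \<otimes> q) = \<zero>"
    using bb xy by (simp flip: b'(2))
  have "d \<otimes> d \<otimes> w = d \<otimes> d"
    using d w dw by (simp add: m_assoc)
  then have "d \<otimes> d = d \<otimes> d \<otimes> (w \<otimes> w \<otimes> w)"
    using d w by (simp flip: m_assoc)
  \<comment> \<open>The binomial cube of \<open>p \<oplus> q\<close>, with each monomial assigned to
    a square it contains; the coefficients 3 are written as repeated sums.\<close>
  also have "w \<otimes> w \<otimes> w = p \<otimes> p \<otimes> (p \<oplus> q \<oplus> q \<oplus> q) \<oplus> q \<otimes> q \<otimes> (q \<oplus> p \<oplus> p \<oplus> p)"
    unfolding w_def p_def[symmetric] q_def[symmetric] using pq by algebra
  also have "d \<otimes> d \<otimes> \<dots> = d \<otimes> d \<otimes> (p \<otimes> p) \<otimes> (p \<oplus> q \<oplus> q \<oplus> q)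
      \<oplus> d \<otimes> d \<otimes> (q \<otimes> q) \<otimes> (q \<oplus> p \<oplus> p \<oplus> p)"
    using d pq by (simp add: r_distr m_assoc)
  also have "\<dots> = \<zero>"
    using ddp ddq pq by simp
  finally have dd: "d \<otimes> d = \<zero>" .
  have "a \<otimes> b = a' \<otimes> b' \<otimes> (d \<otimes> d)"
    unfolding a'(2) b'(2) using a'(1) b'(1) d by algebra
  then have "a \<otimes> b = \<zero>" using dd a'(1) b'(1) by simp
  then show ?thesis
    using PIdl_subset_perp_iff a b pa pb by (metis m_comm subset_antisym)
qed

lemma card_principal_ideals: "card (principal_ideals R) = Suc (card (principal_ideals R - {{\<zero>}}))"
proof -
  have "principal_ideals R \<subseteq> Pow (carrier R)"
    by (auto simp: principal_ideals_def cgenideal_def)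
  then have "finite (principal_ideals R)"
    using finite_carrier finite_subset by blast
  moreover have "PIdl \<zero> = {\<zero>}"
    by (auto simp: cgenideal_def intro: exI[of _ \<zero>])
  then have "{\<zero>} \<in> principal_ideals R"
    unfolding principal_ideals_def by blast
  ultimately show ?thesis by (rule card.remove)
qed

text \<open>The index map given by annihilators is injective, since the ideal at \<open>j\<close> is
  recovered as the annihilator of the one at \<open>p j\<close>. On a finite index set it is then a
  permutation.\<close>

lemma assoc_reps_perp_mat:
  assumes "assoc_reps R t a"
  shows "\<exists>P. permutation_mat (t + 1) P \<and> perp_mat R t a = incl_mat R t a * P"
proof -
  have a: "\<And>i. i < t + 1 \<Longrightarrow> a i \<in> carrier R"
    and bij: "bij_betw (\<lambda>i. PIdl (a i)) {0..<t + 1} (principal_ideals R)"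
    using assms assoc_reps_iff[OF finite_carrier] by (auto simp: atLeastLessThanSuc_atLeastAtMost)
  have "\<exists>k. k < t + 1 \<and> PIdl (a k) = perp R (a j)" if "j < t + 1" for j
  proof -
    have "perp R (a j) \<in> principal_ideals R"
      using perp_principal[OF a[OF that]] by (auto simp: principal_ideals_def)
    then have "perp R (a j) \<in> (\<lambda>i. PIdl (a i)) ` {0..<t + 1}"
      using bij by (simp add: bij_betw_def)
    then obtain k where "k \<in> {0..<t + 1}" "perp R (a j) = PIdl (a k)"
      by (rule imageE)
    then show ?thesis by auto
  qed
  then obtain q where q: "\<And>j. j < t + 1 \<Longrightarrow> q j < t + 1"
    "\<And>j. j < t + 1 \<Longrightarrow> PIdl (a (q j)) = perp R (a j)"
    by metis
  \<comment> \<open>\<open>permutes\<close> requires the identity outside the index range.\<close>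
  define p where "p j = (if j < t + 1 then q j else j)" for j
  have p: "\<And>j. j < t + 1 \<Longrightarrow> p j < t + 1"
    "\<And>j. j < t + 1 \<Longrightarrow> PIdl (a (p j)) = perp R (a j)"
    using q by (auto simp: p_def)
  have "inj_on p {0..<t + 1}"
  proof (rule inj_onI)
    fix i j assume ij: "i \<in> {0..<t + 1}" "j \<in> {0..<t + 1}" and "p i = p j"
    have "PIdl (a k) = perp R (a (p k))" if "k < t + 1" for k
      using perp_PIdl_involution[OF finite_carrier a[OF that] a[OF p(1)[OF that]] p(2)[OF that]] .
    from this[of i] this[of j] have "PIdl (a i) = PIdl (a j)" using ij \<open>p i = p j\<close> by simp
    then show "i = j" using bij ij by (auto simp: bij_betw_def inj_on_def)
  qed
  moreover have "p ` {0..<t + 1} \<subseteq> {0..<t + 1}" using p by auto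
  ultimately have "bij_betw p {0..<t + 1} {0..<t + 1}"
    by (simp add: bij_betw_def endo_inj_surj)
  then have "p permutes {0..<t + 1}"
    by (rule bij_imp_permutes) (auto simp: p_def)
  then have "permutation_mat (t + 1) (mat (t + 1) (t + 1) (\<lambda>(i, j). if i = p j then 1 else 0))"
    unfolding permutation_mat_def by blast
  then show ?thesis
    using perp_mat_eq_incl_mat_mult[of t a p] a p by blast
qed

lemma ex_assoc_reps_antidiag:
  assumes t: "card (principal_ideals R) = t + 1"
  shows "\<exists>a. assoc_reps R t a \<and> perp_mat R t a = incl_mat R t a * antidiag_mat (t + 1)"
proof -
  define gen where "gen I = (SOME c. c \<in> carrier R \<and> I = PIdl c)" for I
  have gen: "gen I \<in> carrier R" "PIdl (gen I) = I" if "I \<in> principal_ideals R" for I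
    using that someI_ex[of "\<lambda>c. c \<in> carrier R \<and> I = PIdl c"]
    by (auto simp: gen_def principal_ideals_def)
  \<comment> \<open>The annihilator as a map on ideals, computed from a chosen generator because
    \<open>perp\<close> takes an element.\<close>
  define f where "f I = perp R (gen I)" for I
  have f: "f I \<in> principal_ideals R" if "I \<in> principal_ideals R" for I
    using perp_principal[OF gen(1)[OF that]] by (auto simp: f_def principal_ideals_def)
  have "f (f I) = I" if I: "I \<in> principal_ideals R" for I
    using perp_PIdl_involution[OF finite_carrier gen(1)[OF I] gen(1)[OF f[OF I]]]
      gen(2)[OF I] gen(2)[OF f[OF I]] by (simp add: f_def)
  moreover have "I = K"
    if "I \<in> principal_ideals R" "K \<in> principal_ideals R" "f I = I" "f K = K" for I K
    using self_perp_unique[of "gen I" "gen K"] gen that by (simp add: f_def)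
  moreover have "finite (principal_ideals R)"
    using t card.infinite by fastforce
  ultimately obtain xs where xs: "distinct xs" "set xs = principal_ideals R" "map f xs = rev xs"
    using involution_list[of "principal_ideals R" f] f by metis
  have len: "length xs = t + 1"
    using xs t distinct_card by metis
  define a where "a i = gen (xs ! i)" for i
  have mem: "xs ! i \<in> principal_ideals R" if "i < t + 1" for i
    using that len xs(2) nth_mem by metis
  have a: "a i \<in> carrier R" "PIdl (a i) = xs ! i" if "i < t + 1" for i
    using gen mem[OF that] by (auto simp: a_def)
  have "bij_betw (\<lambda>i. PIdl (a i)) {0..t} (principal_ideals R) \<longleftrightarrow>
      bij_betw ((!) xs) {0..t} (principal_ideals R)"
    by (rule bij_betw_cong) (use a in auto)
  also have "\<dots>"
    by (rule bij_betw_nth) (use xs len in auto)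
  finally have "bij_betw (\<lambda>i. PIdl (a i)) {0..t} (principal_ideals R)" .
  then have reps: "assoc_reps R t a"
    using a by (simp add: assoc_reps_iff[OF finite_carrier])
  have perp: "PIdl (a (t - j)) = perp R (a j)" if j: "j < t + 1" for j
  proof -
    \<comment> \<open>Position \<open>j\<close> of the reversed list is position
      \<open>t - j\<close> of \<open>xs\<close>, as the length is \<open>t + 1\<close>.\<close>
    have "f (xs ! j) = rev xs ! j"
      using xs(3) j len by (metis nth_map)
    then show ?thesis
      using j len a(2)[of "t - j"] by (simp add: rev_nth f_def a_def)
  qed
  \<comment> \<open>For \<open>j \<le> t\<close>, the condition \<open>i + j + 1 = t + 1\<close> is
    exactly \<open>i = t - j\<close>.\<close>
  have "antidiag_mat (t + 1) = mat (t + 1) (t + 1) (\<lambda>(i, j). if i = t - j then 1 else 0)"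
    unfolding antidiag_mat_def by (intro cong_mat) auto
  then show ?thesis
    using perp_mat_eq_incl_mat_mult[of t a "\<lambda>j. t - j"] a perp reps by auto
qed

end

theorem corollary13:
  fixes R :: "('a, 'b) ring_scheme" and t :: nat
  assumes "finite_principal_ideal_cring R"
    and "t = card (principal_ideals R - {{\<zero>\<^bsub>R\<^esub>}})"
  shows "(\<forall>a. assoc_reps R t a \<longrightarrow>
            (\<exists>P. permutation_mat (t + 1) P \<and> perp_mat R t a = incl_mat R t a * P)) \<and>
         (\<exists>a. assoc_reps R t a \<and> perp_mat R t a = incl_mat R t a * antidiag_mat (t + 1))"
proof -
  interpret finite_principal_ideal_cring R by fact
  have "card (principal_ideals R) = t + 1"
    using card_principal_ideals assms(2) by simp
  then show ?thesis
    using assoc_reps_perp_mat ex_assoc_reps_antidiag by blast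
qed

end
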